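(* Let $X$ be a Banach space. (i) If $X$ is uniformly convex, then $S_{X^*}=\mathcal{A}_{\|\cdot\|}(X,\mathbb{K})$. (ii) There is $x^*\in \mathrm{NA}(\ell_1,\mathbb{K})\cap S_{\ell_\infty}$ such that $x^*\notin\mathcal{A}_{\|\cdot\|}(\ell_1,\mathbb{K})$ (where $\ell_1^*$ is identified with $\ell_\infty$). (iii) There is $x^*\in \mathrm{NA}(\ell_\infty,\mathbb{K})\cap S_{\ell_\infty^*}$ such that $x^*\notin\mathcal{A}_{\|\cdot\|}(\ell_\infty,\mathbb{K})$.
   Context: Banach spaces are over $\mathbb{K}=\mathbb{R}$ or $\mathbb{C}$; $S_X$ is the unit sphere of $X$, $X^*$ the topological dual, and $\mathcal{L}(X,Y)$ the bounded linear operators from $X$ to $Y$. An operator $T\in\mathcal{L}(X,Y)$ attains its norm if $\|T(x_0)\|=\|T\|$ for some $x_0\in S_X$; $\mathrm{NA}(X,Y)$ denotes the set of norm-attaining operators from $X$ to $Y$. $\mathcal{A}_{\|\cdot\|}(X,Y)$ is the set of all norm-attaining $T\in\mathcal{L}(X,Y)$ with $\|T\|=1$ such that for every $\varepsilon>0$ there is $\eta(\varepsilon,T)>0$ such that whenever $x\in S_X$ satisfies $\|T(x)\|>1-\eta(\varepsilon,T)$, there is $x_0\in S_X$ with $\|T(x_0)\|=1$ and $\|x_0-x\|<\varepsilon$. *)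

theory Defs
  imports "HOL-Analysis.Analysis"
begin

text \<open>
  The class \<open>banach\<close> only knows real scalars.  A Banach space over \<open>'k\<close> (used below
  for \<open>'k = real\<close> and \<open>'k = complex\<close>) is a type of that class together with a
  \<open>'k\<close>-scalar multiplication that extends \<open>scaleR\<close> and for which the norm is
  homogeneous.
\<close>

locale banach_over = vector_space scale
  for scale :: "'k::real_normed_field \<Rightarrow> 'a::banach \<Rightarrow> 'a" +
  assumes norm_scale: "norm (scale c x) = norm c * norm x"
    and scale_of_real: "scale (of_real r) x = r *\<^sub>R x"

lemma banach_over_scaleR: "banach_over (scaleR :: real \<Rightarrow> 'a::banach \<Rightarrow> 'a)"
  by unfold_locales (auto simp: scaleR_right_distrib scaleR_left_distrib)

lemma banach_over_mult: "banach_over ((*) :: 'k::{real_normed_field,banach} \<Rightarrow> 'k \<Rightarrow> 'k)"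
  by unfold_locales (auto simp: algebra_simps norm_mult scaleR_conv_of_real)

definition uniformly_convex :: "'a::real_normed_vector itself \<Rightarrow> bool" where
  "uniformly_convex _ \<longleftrightarrow>
     (\<forall>\<epsilon>>0. \<exists>\<delta>>0. \<forall>x\<in>sphere (0::'a) 1. \<forall>y\<in>sphere 0 1.
        \<epsilon> \<le> norm (x - y) \<longrightarrow> norm ((1/2) *\<^sub>R (x + y)) \<le> 1 - \<delta>)"

text \<open>
  The norm of \<open>'a \<Rightarrow>\<^sub>L 'b\<close> is the operator norm, which does not depend on the scalar
  field, so the bounded \<open>'k\<close>-linear operators are the \<open>'k\<close>-homogeneous elements of
  that type.
\<close>

definition bounded_ops ::
  "('k \<Rightarrow> 'a \<Rightarrow> 'a) \<Rightarrow> ('k \<Rightarrow> 'b \<Rightarrow> 'b) \<Rightarrow>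
   ('a::real_normed_vector \<Rightarrow>\<^sub>L 'b::real_normed_vector) set"
  where "bounded_ops sX sY = {T. \<forall>c x. blinfun_apply T (sX c x) = sY c (blinfun_apply T x)}"

definition NA ::
  "('k \<Rightarrow> 'a \<Rightarrow> 'a) \<Rightarrow> ('k \<Rightarrow> 'b \<Rightarrow> 'b) \<Rightarrow>
   ('a::real_normed_vector \<Rightarrow>\<^sub>L 'b::real_normed_vector) set"
  where "NA sX sY =
    {T \<in> bounded_ops sX sY. \<exists>x\<^sub>0\<in>sphere 0 1. norm (blinfun_apply T x\<^sub>0) = norm T}"

definition A_norm ::
  "('k \<Rightarrow> 'a \<Rightarrow> 'a) \<Rightarrow> ('k \<Rightarrow> 'b \<Rightarrow> 'b) \<Rightarrow>
   ('a::real_normed_vector \<Rightarrow>\<^sub>L 'b::real_normed_vector) set"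
  where "A_norm sX sY =
    {T \<in> NA sX sY. norm T = 1 \<and>
       (\<forall>\<epsilon>>0. \<exists>\<eta>>0. \<forall>x\<in>sphere 0 1. 1 - \<eta> < norm (blinfun_apply T x) \<longrightarrow>
          (\<exists>x\<^sub>0\<in>sphere 0 1. norm (blinfun_apply T x\<^sub>0) = 1 \<and> norm (x\<^sub>0 - x) < \<epsilon>))}"

abbreviation dual_sphere ::
  "('k \<Rightarrow> 'a \<Rightarrow> 'a) \<Rightarrow> ('a::real_normed_vector \<Rightarrow>\<^sub>L 'k::real_normed_field) set"
  where "dual_sphere sX \<equiv> bounded_ops sX (*) \<inter> sphere 0 1"

text \<open>
  The topology of \<open>nat\<close> is discrete, so bounded continuous functions on \<open>nat\<close> with
  the supremum norm are exactly the bounded sequences.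
\<close>

type_synonym 'k linf = "nat \<Rightarrow>\<^sub>C 'k"

lemma bcontfun_nat_iff: "f \<in> bcontfun \<longleftrightarrow> bounded (range f)"
  for f :: "nat \<Rightarrow> 'k::metric_space"
  by (auto simp: bcontfun_def)

definition linf_scale :: "'k::real_normed_field \<Rightarrow> 'k linf \<Rightarrow> 'k linf"
  where "linf_scale c y = Bcontfun (\<lambda>n. c * apply_bcontfun y n)"

lemma apply_linf_scale [simp]: "apply_bcontfun (linf_scale c y) n = c * apply_bcontfun y n"
proof -
  have "norm (c * apply_bcontfun y n) \<le> norm c * norm y" for n
    by (simp add: norm_mult mult_left_mono norm_bounded)
  then have "(\<lambda>n. c * apply_bcontfun y n) \<in> bcontfun"
    unfolding bcontfun_nat_iff bounded_iff by blast
  then show ?thesis by (simp add: linf_scale_def Bcontfun_inverse)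
qed

text \<open>
  The library proves completeness for functions on metric spaces only; \<open>nat\<close> is not
  an instance of \<open>metric_space\<close>, so the arity is generalised here.
\<close>

instance bcontfun :: (topological_space, complete_space) complete_space
proof
  fix f :: "nat \<Rightarrow> 'a \<Rightarrow>\<^sub>C 'b"
  assume "Cauchy f"
  then obtain g where g: "uniform_limit UNIV (\<lambda>n. apply_bcontfun (f n)) g sequentially"
    using uniformly_convergent_eq_cauchy[of "\<lambda>_. True" "\<lambda>n. apply_bcontfun (f n)"]
    unfolding Cauchy_def uniform_limit_sequentially_iff
    by (metis dist_fun_lt_imp_dist_val_lt)
  from uniform_limit_bcontfunE[OF g sequentially_bot] obtain l where "f \<longlonglongrightarrow> l"
    by metis
  then show "convergent f" by (auto simp: convergent_def)
qed

instance bcontfun :: (topological_space, banach) banach ..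

lemma norm_linf_le: "(\<And>n. norm (apply_bcontfun y n) \<le> C) \<Longrightarrow> norm y \<le> C"
  for y :: "'k::real_normed_vector linf"
  by (rule norm_bound)

lemma banach_over_linf: "banach_over (linf_scale :: 'k::{real_normed_field,banach} \<Rightarrow> _)"
proof (unfold_locales, goal_cases)
  case (5 c y)
  have le: "norm (linf_scale c y) \<le> norm c * norm y" for c and y :: "'k linf"
    by (rule norm_linf_le)
       (simp add: norm_mult mult_left_mono norm_bounded)
  show ?case
  proof (cases "c = 0")
    case True
    then have "linf_scale c y = 0" by (intro bcontfun_eqI) simp
    with True show ?thesis by simp
  next
    case False
    have "y = linf_scale (inverse c) (linf_scale c y)"
      using False by (intro bcontfun_eqI) simp
    then have "norm y \<le> inverse (norm c) * norm (linf_scale c y)"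
      using le[of "inverse c" "linf_scale c y"] by (simp add: norm_inverse)
    then have "norm c * norm y \<le> norm (linf_scale c y)"
      using False by (simp add: field_simps)
    with le[of c y] show ?thesis by simp
  qed
qed (intro bcontfun_eqI, simp add: algebra_simps scaleR_conv_of_real)+

typedef (overloaded) 'k l1 = "{x :: nat \<Rightarrow> 'k::real_normed_vector. summable (\<lambda>n. norm (x n))}"
  morphisms seq_l1 Abs_l1
  by (rule exI[of _ "\<lambda>_. 0"]) simp

setup_lifting type_definition_l1

lemma summable_norm_seq_l1: "summable (\<lambda>n. norm (seq_l1 x n))"
  using seq_l1[of x] by simp

lemma summable_norm_plus:
  fixes x y :: "nat \<Rightarrow> 'k::real_normed_vector"
  assumes "summable (\<lambda>n. norm (x n))" "summable (\<lambda>n. norm (y n))"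
  shows "summable (\<lambda>n. norm (x n + y n))"
  by (rule summable_comparison_test'[OF summable_add[OF assms], of 0])
     (simp add: norm_triangle_ineq)

instantiation l1 :: (real_normed_vector) real_normed_vector
begin

lift_definition zero_l1 :: "'a l1" is "\<lambda>_. 0" by simp
lift_definition plus_l1 :: "'a l1 \<Rightarrow> 'a l1 \<Rightarrow> 'a l1" is "\<lambda>x y n. x n + y n"
  by (rule summable_norm_plus)
lift_definition uminus_l1 :: "'a l1 \<Rightarrow> 'a l1" is "\<lambda>x n. - x n" by simp
lift_definition minus_l1 :: "'a l1 \<Rightarrow> 'a l1 \<Rightarrow> 'a l1" is "\<lambda>x y n. x n - y n"
  subgoal for x y using summable_norm_plus[of x "\<lambda>n. - y n"] by simp
  done
lift_definition scaleR_l1 :: "real \<Rightarrow> 'a l1 \<Rightarrow> 'a l1" is "\<lambda>r x n. r *\<^sub>R x n"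
  by (simp add: summable_mult)
lift_definition norm_l1 :: "'a l1 \<Rightarrow> real" is "\<lambda>x. \<Sum>n. norm (x n)" .
definition dist_l1 :: "'a l1 \<Rightarrow> 'a l1 \<Rightarrow> real" where "dist_l1 x y = norm (x - y)"
definition sgn_l1 :: "'a l1 \<Rightarrow> 'a l1" where "sgn_l1 x = inverse (norm x) *\<^sub>R x"
definition uniformity_l1 :: "('a l1 \<times> 'a l1) filter" where
  "uniformity_l1 = (INF e\<in>{0<..}. principal {(x, y). dist x y < e})"
definition open_l1 :: "'a l1 set \<Rightarrow> bool" where
  "open_l1 U = (\<forall>x\<in>U. eventually (\<lambda>(x', y). x' = x \<longrightarrow> y \<in> U) uniformity)"

instance
proof
  fix x y :: "'a l1" and r :: real
  show "(norm x = 0) = (x = 0)"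
    by transfer (auto simp: suminf_eq_zero_iff)
  show "norm (x + y) \<le> norm x + norm y"
  proof (transfer, simp)
    fix x y :: "nat \<Rightarrow> 'a"
    assume *: "summable (\<lambda>n. norm (x n))" "summable (\<lambda>n. norm (y n))"
    have "(\<Sum>n. norm (x n + y n)) \<le> (\<Sum>n. norm (x n) + norm (y n))"
      by (intro suminf_le summable_norm_plus summable_add * norm_triangle_ineq)
    then show "(\<Sum>n. norm (x n + y n)) \<le> (\<Sum>n. norm (x n)) + (\<Sum>n. norm (y n))"
      using suminf_add[OF *] by simp
  qed
  show "norm (r *\<^sub>R x) = \<bar>r\<bar> * norm x"
    by transfer (simp add: suminf_mult)
qed (transfer; simp add: algebra_simps dist_l1_def sgn_l1_def uniformity_l1_def open_l1_def
      | simp add: dist_l1_def sgn_l1_def uniformity_l1_def open_l1_def)+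

end

lemma sum_le_norm_l1: "(\<Sum>n<m. norm (seq_l1 x n)) \<le> norm x"
  unfolding norm_l1.rep_eq by (rule sum_le_suminf[OF summable_norm_seq_l1]) auto

lemma norm_seq_l1_le: "norm (seq_l1 x n) \<le> norm x"
  using sum_le_norm_l1[of x "Suc n"] sum_nonneg[of "{..<n}" "\<lambda>n. norm (seq_l1 x n)"] by simp

instance l1 :: (banach) banach
proof
  fix X :: "nat \<Rightarrow> 'a l1"
  assume X: "Cauchy X"
  have "\<exists>z. (\<lambda>i. seq_l1 (X i) n) \<longlonglongrightarrow> z" for n
  proof -
    have "Cauchy (\<lambda>i. seq_l1 (X i) n)"
    proof (rule metric_CauchyI)
      fix e :: real assume "e > 0"
      with X obtain M where M: "\<And>i j. i \<ge> M \<Longrightarrow> j \<ge> M \<Longrightarrow> dist (X i) (X j) < e"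
        unfolding Cauchy_def by blast
      have "dist (seq_l1 (X i) n) (seq_l1 (X j) n) \<le> dist (X i) (X j)" for i j
        using norm_seq_l1_le[of "X i - X j" n] by (simp add: dist_norm minus_l1.rep_eq)
      with M show "\<exists>M. \<forall>i\<ge>M. \<forall>j\<ge>M. dist (seq_l1 (X i) n) (seq_l1 (X j) n) < e"
        by (meson le_less_trans)
    qed
    then show ?thesis by (simp add: Cauchy_convergent_iff convergent_def)
  qed
  then obtain z where z: "\<And>n. (\<lambda>i. seq_l1 (X i) n) \<longlonglongrightarrow> z n" by metis
  have tail: "\<exists>M. \<forall>i\<ge>M. \<forall>m. (\<Sum>n<m. norm (seq_l1 (X i) n - z n)) \<le> e" if "e > 0" for e
  proof -
    from X that obtain M where M: "\<And>i j. i \<ge> M \<Longrightarrow> j \<ge> M \<Longrightarrow> dist (X i) (X j) < e"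
      unfolding Cauchy_def by blast
    have "(\<Sum>n<m. norm (seq_l1 (X i) n - z n)) \<le> e" if "i \<ge> M" for i m
    proof (rule tendsto_upperbound)
      show "(\<lambda>j. \<Sum>n<m. norm (seq_l1 (X i) n - seq_l1 (X j) n))
              \<longlonglongrightarrow> (\<Sum>n<m. norm (seq_l1 (X i) n - z n))"
        by (intro tendsto_intros z)
      have "(\<Sum>n<m. norm (seq_l1 (X i) n - seq_l1 (X j) n)) \<le> e" if "j \<ge> M" for j
        using sum_le_norm_l1[of "X i - X j" m] M[OF \<open>i \<ge> M\<close> that]
        by (simp add: dist_norm minus_l1.rep_eq)
      then show "\<forall>\<^sub>F j in sequentially. (\<Sum>n<m. norm (seq_l1 (X i) n - seq_l1 (X j) n)) \<le> e"
        unfolding eventually_sequentially by blast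
    qed simp
    then show ?thesis by blast
  qed
  obtain M where M: "\<And>m. (\<Sum>n<m. norm (seq_l1 (X M) n - z n)) \<le> 1"
    using tail[of 1] by auto
  have "summable (\<lambda>n. norm (seq_l1 (X M) n - z n))"
    using M by (intro summableI_nonneg_bounded[where x=1]) auto
  from summable_norm_plus[of "\<lambda>n. - (seq_l1 (X M) n - z n)", OF _ summable_norm_seq_l1[of "X M"]] this
  have "summable (\<lambda>n. norm (z n))" by (simp add: norm_minus_commute)
  then have Z: "seq_l1 (Abs_l1 z) = z" by (simp add: Abs_l1_inverse)
  have "X \<longlonglongrightarrow> Abs_l1 z"
  proof (rule metric_LIMSEQ_I)
    fix e :: real assume "e > 0"
    then obtain M where M: "\<And>i m. i \<ge> M \<Longrightarrow> (\<Sum>n<m. norm (seq_l1 (X i) n - z n)) \<le> e / 2"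
      using tail[of "e / 2"] by auto
    have "dist (X i) (Abs_l1 z) < e" if "i \<ge> M" for i
    proof -
      have "norm (X i - Abs_l1 z) \<le> e / 2"
        unfolding norm_l1.rep_eq
        using M[OF that] by (intro suminf_le_const summable_norm_seq_l1)
                            (simp add: minus_l1.rep_eq Z)
      with \<open>e > 0\<close> show ?thesis by (simp add: dist_norm)
    qed
    then show "\<exists>M. \<forall>i\<ge>M. dist (X i) (Abs_l1 z) < e" by blast
  qed
  then show "convergent X" by (auto simp: convergent_def)
qed

lift_definition l1_scale ::
  "'k::real_normed_field \<Rightarrow> 'k l1 \<Rightarrow> 'k l1" is "\<lambda>c x n. c * x n"
  by (simp add: norm_mult summable_mult)

lemma banach_over_l1: "banach_over (l1_scale :: 'k::{real_normed_field,banach} \<Rightarrow> _)"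
proof (unfold_locales, goal_cases)
  case (5 c x)
  then show ?case by transfer (simp add: norm_mult suminf_mult)
qed (transfer; auto simp: algebra_simps scaleR_conv_of_real)+

lemma summable_l1_linf:
  fixes y :: "'k::{real_normed_field,banach} linf"
  shows "summable (\<lambda>n. norm (apply_bcontfun y n * seq_l1 x n))"
  by (rule summable_comparison_test'[OF summable_mult[OF summable_norm_seq_l1[of x], of "norm y"], of 0])
     (simp add: norm_mult mult_right_mono norm_bounded)

text \<open>
  The identification of the dual of \<open>l1\<close> with \<open>linf\<close>; that it is an isometric bijection is
  \<open>norm_l1_functional\<close> and \<open>bij_betw_l1_functional\<close> below.
\<close>

lift_definition l1_functional ::
  "'k::{real_normed_field,banach} linf \<Rightarrow> ('k l1 \<Rightarrow>\<^sub>L 'k)"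
  is "\<lambda>y x. \<Sum>n. apply_bcontfun y n * seq_l1 x n"
proof (rule bounded_linear_intro)
  fix y :: "'k linf" and x x' :: "'k l1" and r :: real
  note s = summable_norm_cancel[OF summable_l1_linf]
  show "(\<Sum>n. apply_bcontfun y n * seq_l1 (x + x') n) =
        (\<Sum>n. apply_bcontfun y n * seq_l1 x n) + (\<Sum>n. apply_bcontfun y n * seq_l1 x' n)"
    by (simp add: plus_l1.rep_eq distrib_left suminf_add[OF s s])
  show "(\<Sum>n. apply_bcontfun y n * seq_l1 (r *\<^sub>R x) n) =
        r *\<^sub>R (\<Sum>n. apply_bcontfun y n * seq_l1 x n)"
    by (simp add: scaleR_l1.rep_eq suminf_scaleR_right[OF s])
  have "norm (\<Sum>n. apply_bcontfun y n * seq_l1 x n)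
          \<le> (\<Sum>n. norm (apply_bcontfun y n * seq_l1 x n))"
    by (rule summable_norm[OF summable_l1_linf])
  also have "\<dots> \<le> (\<Sum>n. norm y * norm (seq_l1 x n))"
    by (intro suminf_le summable_l1_linf summable_mult summable_norm_seq_l1)
       (simp add: norm_mult mult_right_mono norm_bounded)
  also have "\<dots> = norm x * norm y"
    by (simp add: norm_l1.rep_eq suminf_mult[OF summable_norm_seq_l1])
  finally show "norm (\<Sum>n. apply_bcontfun y n * seq_l1 x n) \<le> norm x * norm y" .
qed

lift_definition unit_l1 :: "nat \<Rightarrow> 'k::real_normed_field l1"
  is "\<lambda>m n. if n = m then 1 else 0"
  subgoal for m by (rule summable_finite[of "{m}"]) auto
  done

lemma norm_unit_l1 [simp]: "norm (unit_l1 m :: 'k::real_normed_field l1) = 1"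
proof transfer
  fix m
  show "(\<Sum>n. norm (if n = m then 1 else 0 :: 'k)) = 1"
    by (subst suminf_finite[of "{m}"]) auto
qed

lemma l1_functional_unit [simp]:
  "blinfun_apply (l1_functional y) (unit_l1 m) = apply_bcontfun y m"
  by (simp add: l1_functional.rep_eq unit_l1.rep_eq if_distrib, subst suminf_finite[of "{m}"]) auto

lemma norm_l1_functional: "norm (l1_functional y) = norm y"
proof (rule antisym)
  have "norm (blinfun_apply (l1_functional y) x) \<le> norm y * norm x" for x
  proof -
    have "norm (\<Sum>n. apply_bcontfun y n * seq_l1 x n)
            \<le> (\<Sum>n. norm (apply_bcontfun y n * seq_l1 x n))"
      by (rule summable_norm[OF summable_l1_linf])
    also have "\<dots> \<le> (\<Sum>n. norm y * norm (seq_l1 x n))"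
      by (intro suminf_le summable_l1_linf summable_mult summable_norm_seq_l1)
         (simp add: norm_mult mult_right_mono norm_bounded)
    also have "\<dots> = norm y * norm x"
      by (simp add: norm_l1.rep_eq suminf_mult[OF summable_norm_seq_l1])
    finally show ?thesis by (simp add: l1_functional.rep_eq)
  qed
  then show "norm (l1_functional y) \<le> norm y" by (intro norm_blinfun_bound) auto
  show "norm y \<le> norm (l1_functional y)"
    by (rule norm_linf_le) (use norm_blinfun[of "l1_functional y" "unit_l1 _"] in simp)
qed

lemma bij_betw_l1_functional:
  "bij_betw l1_functional UNIV
     (bounded_ops (l1_scale :: 'k::{real_normed_field,banach} \<Rightarrow> _) (*))"
proof (rule bij_betw_imageI)
  show "inj (l1_functional :: 'k linf \<Rightarrow> _)"
    by (rule injI, rule bcontfun_eqI) (metis l1_functional_unit)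
  show "range l1_functional = bounded_ops (l1_scale :: 'k \<Rightarrow> _) (*)"
  proof (intro equalityI subsetI)
    fix f assume "f \<in> range (l1_functional :: 'k linf \<Rightarrow> _)"
    then obtain y :: "'k linf" where f: "f = l1_functional y" by blast
    show "f \<in> bounded_ops l1_scale (*)"
      unfolding f bounded_ops_def
      by (simp add: l1_functional.rep_eq l1_scale.rep_eq mult.left_commute
            suminf_mult[OF summable_norm_cancel[OF summable_l1_linf]])
  next
    fix f assume f: "f \<in> bounded_ops (l1_scale :: 'k \<Rightarrow> _) (*)"
    let ?y = "\<lambda>n. blinfun_apply f (unit_l1 n)"
    have "norm (?y n) \<le> norm f" for n
      using norm_blinfun[of f "unit_l1 n"] by simp
    then have "?y \<in> bcontfun"
      unfolding bcontfun_nat_iff bounded_iff by blast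
    then obtain y :: "'k linf" where y: "\<And>n. apply_bcontfun y n = ?y n"
      by (metis Bcontfun_inverse)
    have "blinfun_apply f x = blinfun_apply (l1_functional y) x" for x
    proof -
      define P where "P m = (\<Sum>n<m. l1_scale (seq_l1 x n) (unit_l1 n))" for m
      have P: "seq_l1 (P m) k = (if k < m then seq_l1 x k else 0)" for m k
        unfolding P_def
        by (induction m)
           (auto simp: zero_l1.rep_eq plus_l1.rep_eq l1_scale.rep_eq unit_l1.rep_eq less_Suc_eq)
      have "norm (x - P m) = norm x - (\<Sum>n<m. norm (seq_l1 x n))" for m
      proof -
        have "norm (x - P m) = (\<Sum>n. norm (seq_l1 (x - P m) (n + m))) +
                (\<Sum>n<m. norm (seq_l1 (x - P m) n))"
          unfolding norm_l1.rep_eq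
          by (rule suminf_split_initial_segment[OF summable_norm_seq_l1])
        also have "\<dots> = (\<Sum>n. norm (seq_l1 x (n + m)))"
          by (simp add: minus_l1.rep_eq P)
        also have "\<dots> = norm x - (\<Sum>n<m. norm (seq_l1 x n))"
          unfolding norm_l1.rep_eq
          by (rule suminf_minus_initial_segment[OF summable_norm_seq_l1])
        finally show ?thesis .
      qed
      moreover have "(\<lambda>m. norm x - (\<Sum>n<m. norm (seq_l1 x n))) \<longlonglongrightarrow> norm x - norm x"
        unfolding norm_l1.rep_eq
        by (intro tendsto_intros summable_LIMSEQ summable_norm_seq_l1)
      ultimately have "(\<lambda>m. norm (x - P m)) \<longlonglongrightarrow> 0" by simp
      then have "P \<longlonglongrightarrow> x"
        by (simp add: tendsto_iff dist_norm norm_minus_commute)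
      then have "(\<lambda>m. blinfun_apply f (P m)) \<longlonglongrightarrow> blinfun_apply f x"
        by (intro tendsto_intros)
      moreover have "blinfun_apply f (P m) = (\<Sum>n<m. apply_bcontfun y n * seq_l1 x n)" for m
        using f by (simp add: P_def blinfun.sum_right bounded_ops_def y mult.commute)
      ultimately have "(\<lambda>n. apply_bcontfun y n * seq_l1 x n) sums blinfun_apply f x"
        by (simp add: sums_def)
      then show ?thesis by (simp add: l1_functional.rep_eq sums_iff)
    qed
    then have "f = l1_functional y" by (intro blinfun_eqI)
    then show "f \<in> range l1_functional" by blast
  qed
qed

end

theory Submission
  imports Defs
begin

text \<open>
  (i) If \<open>T\<close> has norm 1 and takes real values close to 1 at two unit vectors, then their midpoint
  has norm close to 1, hence uniform convexity makes the two vectors close.  Every vector can be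
  rotated so that \<open>T\<close> is real there.  Applied to a maximising sequence this gives a Cauchy sequence,
  whose limit norms \<open>T\<close>; applied to that limit and a rotated almost norming vector it gives the
  defining property of the class.

  (ii), (iii) Equality in \<open>\<bar>\<Sum>y\<^sub>n x\<^sub>n\<bar> \<le> \<parallel>y\<parallel> \<parallel>x\<parallel>\<close> forces \<open>\<bar>y\<^sub>n\<bar> = \<parallel>y\<parallel>\<close> wherever \<open>x\<^sub>n \<noteq> 0\<close>.
  With \<open>y = (1, 1/2, 2/3, \<dots>)\<close> the functional on \<open>\<ell>\<^sub>1\<close> is normed only by vectors supported on the
  first coordinate, although the unit vectors \<open>e\<^sub>n\<close> almost norm it.  With \<open>x\<^sub>n = 2\<^sup>-\<^sup>(\<^sup>n\<^sup>+\<^sup>1\<^sup>)\<close> the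
  functional on \<open>\<ell>\<^sub>\<infinity>\<close> is normed only by unimodular sequences, although the vectors
  \<open>(1, \<dots>, 1, 0, 1, \<dots>)\<close> almost norm it.
\<close>

section \<open>Uniformly convex spaces\<close>

lemma ex_almost_norming:
  fixes T :: "'a::real_normed_vector \<Rightarrow>\<^sub>L 'b::real_normed_vector"
  assumes "b < norm T" "0 < norm T"
  shows "\<exists>x\<in>sphere 0 1. b < norm (blinfun_apply T x)"
proof (rule ccontr)
  assume neg: "\<not> ?thesis"
  \<comment> \<open>Rescaling to the sphere gives the constant \<open>b\<close>;
    \<open>max 0 b\<close> also serves negative \<open>b\<close>, since a bound on the operator norm
    must be nonnegative.\<close>
  have "norm (blinfun_apply T x) \<le> max 0 b * norm x" for x
  proof (cases "x = 0")
    case False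
    have "norm (blinfun_apply T (inverse (norm x) *\<^sub>R x)) \<le> b"
      using neg False by (force simp: not_less)
    then have "norm (blinfun_apply T x) \<le> b * norm x"
      using False by (simp add: blinfun.scaleR_right field_simps)
    also have "\<dots> \<le> max 0 b * norm x"
      by (intro mult_right_mono) auto
    finally show ?thesis .
  qed simp
  then have "norm T \<le> max 0 b"
    by (intro norm_blinfun_bound) auto
  with assms show False by (simp add: max_def split: if_splits)
qed

context banach_over
begin

text \<open>Two values of modulus near 1 may cancel when added. Multiplying the vectors by
  unimodular scalars makes both values nonnegative reals, as the midpoint argument requires.\<close>

lemma ex_rotation:
  fixes T :: "'a \<Rightarrow>\<^sub>L 'k"
  assumes "T \<in> bounded_ops scale (*)"
  shows "\<exists>c. norm c = 1 \<and>
    blinfun_apply T (scale c x) = of_real (norm (blinfun_apply T x))"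
proof (cases "blinfun_apply T x = 0")
  case True
  with assms show ?thesis
    by (intro exI[of _ 1]) (simp add: bounded_ops_def)
next
  case False
  with assms show ?thesis
    by (intro exI[of _ "of_real (norm (blinfun_apply T x)) / blinfun_apply T x"])
       (simp add: bounded_ops_def norm_divide)
qed

text \<open>\<open>\<delta>\<close> is the convexity modulus of \<open>\<epsilon>\<close> itself:
  the midpoint has value \<open>(a + b) / 2 > 1 - \<delta>\<close>, hence norm above
  \<open>1 - \<delta>\<close>.\<close>

lemma uniformly_convex_norming_close:
  fixes T :: "'a \<Rightarrow>\<^sub>L 'k"
  assumes "uniformly_convex TYPE('a)" "\<epsilon> > 0" and T: "norm T = 1"
  shows "\<exists>\<delta>>0. \<forall>x y a b. norm x = 1 \<longrightarrow> norm y = 1 \<longrightarrow>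
    blinfun_apply T x = of_real a \<longrightarrow> blinfun_apply T y = of_real b \<longrightarrow>
    1 - \<delta> < a \<longrightarrow> 1 - \<delta> < b \<longrightarrow> norm (x - y) < \<epsilon>"
proof -
  from assms obtain \<delta> where \<delta>: "\<delta> > 0" and uc: "\<And>x y :: 'a. norm x = 1 \<Longrightarrow> norm y = 1 \<Longrightarrow>
      \<epsilon> \<le> norm (x - y) \<Longrightarrow> norm ((1/2) *\<^sub>R (x + y)) \<le> 1 - \<delta>"
    unfolding uniformly_convex_def by (metis mem_sphere_0)
  have "norm (x - y) < \<epsilon>"
    if xy: "norm x = 1" "norm y = 1"
      and Tx: "blinfun_apply T x = of_real a" and Ty: "blinfun_apply T y = of_real b"
      and ab: "1 - \<delta> < a" "1 - \<delta> < b"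
    for x y a b
  proof (rule ccontr)
    assume "\<not> ?thesis"
    then have le: "norm ((1/2) *\<^sub>R (x + y)) \<le> 1 - \<delta>" using uc xy by simp
    have "blinfun_apply T ((1/2) *\<^sub>R (x + y)) = of_real ((a + b) / 2)"
      by (simp add: blinfun.scaleR_right blinfun.add_right Tx Ty scaleR_conv_of_real)
    then have "\<bar>(a + b) / 2\<bar> \<le> norm ((1/2) *\<^sub>R (x + y))"
      using norm_blinfun[of T "(1/2) *\<^sub>R (x + y)"] T by (metis mult_1 norm_of_real)
    with le ab show False by argo
  qed
  with \<delta> show ?thesis by blast
qed

lemma uniformly_convex_ex_norming:
  fixes T :: "'a \<Rightarrow>\<^sub>L 'k"
  assumes uc: "uniformly_convex TYPE('a)" and T: "T \<in> bounded_ops scale (*)" "norm T = 1"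
  shows "\<exists>x. norm x = 1 \<and> blinfun_apply T x = 1"
proof -
  \<comment> \<open>\<open>r\<close> is the modulus of \<open>T\<close> at an almost norming vector,
    which the rotation turns into the value itself; \<open>r \<le> 1\<close> is for the sandwich
    below.\<close>
  have "\<exists>x r. norm x = 1 \<and> blinfun_apply T x = of_real r \<and> 1 - 1 / real (Suc n) < r \<and> r \<le> 1" for n
  proof -
    obtain u where u: "norm u = 1" "1 - 1 / real (Suc n) < norm (blinfun_apply T u)"
      using ex_almost_norming[of "1 - 1 / real (Suc n)" T] T by auto
    moreover have "norm (blinfun_apply T u) \<le> 1"
      using norm_blinfun[of T u] u T by simp
    ultimately show ?thesis
      using ex_rotation[OF T(1), of u] norm_scale by (metis mult_1)
  qed
  then obtain X r where X: "\<And>n. norm (X n) = 1"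
    and TX: "\<And>n. blinfun_apply T (X n) = of_real (r n)"
    and r: "\<And>n. 1 - 1 / real (Suc n) < r n" "\<And>n. r n \<le> 1"
    by metis
  have r_lim: "r \<longlonglongrightarrow> 1"
  proof (rule tendsto_sandwich[where h = "\<lambda>_. 1"])
    show "(\<lambda>n. 1 - 1 / real (Suc n)) \<longlonglongrightarrow> 1"
      using tendsto_diff[OF tendsto_const LIMSEQ_inverse_real_of_nat, of 1]
      by (simp add: inverse_eq_divide)
  qed (use less_imp_le[OF r(1)] r(2) in \<open>simp_all\<close>)
  have "Cauchy X"
  proof (rule CauchyI)
    fix e :: real assume "e > 0"
    obtain \<delta> where \<delta>: "\<delta> > 0"
      "\<And>x y a b. norm x = 1 \<Longrightarrow> norm y = 1 \<Longrightarrow> blinfun_apply T x = of_real a \<Longrightarrow>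
         blinfun_apply T y = of_real b \<Longrightarrow> 1 - \<delta> < a \<Longrightarrow> 1 - \<delta> < b \<Longrightarrow> norm (x - y) < e"
      using uniformly_convex_norming_close[OF uc \<open>e > 0\<close> T(2)] by blast
    have "\<forall>\<^sub>F n in sequentially. 1 - \<delta> < r n"
      using r_lim \<delta>(1) by (intro order_tendstoD(1)) auto
    then obtain M where "\<And>n. n \<ge> M \<Longrightarrow> 1 - \<delta> < r n"
      unfolding eventually_sequentially by blast
    with \<delta>(2)[OF X X TX TX] show "\<exists>M. \<forall>m\<ge>M. \<forall>n\<ge>M. norm (X m - X n) < e"
      by blast
  qed
  then obtain x where x: "X \<longlonglongrightarrow> x"
    by (auto simp: Cauchy_convergent_iff convergent_def)
  have "norm x = 1"
    using tendsto_norm[OF x] X by (simp add: LIMSEQ_const_iff)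
  moreover have "(\<lambda>n. blinfun_apply T (X n)) \<longlonglongrightarrow> blinfun_apply T x"
    by (intro tendsto_intros x)
  moreover have "(\<lambda>n. blinfun_apply T (X n)) \<longlonglongrightarrow> 1"
    using tendsto_of_real[OF r_lim, where 'a='k] by (simp add: TX)
  ultimately show ?thesis
    using LIMSEQ_unique by blast
qed

theorem uniformly_convex_dual_sphere_eq:
  assumes uc: "uniformly_convex TYPE('a)"
  shows "dual_sphere scale = A_norm scale (*)"
proof (intro equalityI subsetI)
  fix T :: "'a \<Rightarrow>\<^sub>L 'k"
  assume "T \<in> dual_sphere scale"
  then have T: "T \<in> bounded_ops scale (*)" "norm T = 1" by auto
  from uniformly_convex_ex_norming[OF uc T] obtain z where z: "norm z = 1" "blinfun_apply T z = 1"
    by blast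
  have "\<exists>\<eta>>0. \<forall>x\<in>sphere 0 1. 1 - \<eta> < norm (blinfun_apply T x) \<longrightarrow>
          (\<exists>x\<^sub>0\<in>sphere 0 1. norm (blinfun_apply T x\<^sub>0) = 1 \<and> norm (x\<^sub>0 - x) < \<epsilon>)"
    if "\<epsilon> > 0" for \<epsilon>
  proof -
    obtain \<delta> where \<delta>: "\<delta> > 0"
      "\<And>x y a b. norm x = 1 \<Longrightarrow> norm y = 1 \<Longrightarrow> blinfun_apply T x = of_real a \<Longrightarrow>
         blinfun_apply T y = of_real b \<Longrightarrow> 1 - \<delta> < a \<Longrightarrow> 1 - \<delta> < b \<Longrightarrow> norm (x - y) < \<epsilon>"
      using uniformly_convex_norming_close[OF uc \<open>\<epsilon> > 0\<close> T(2)] by blast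
    have "\<exists>x\<^sub>0\<in>sphere 0 1. norm (blinfun_apply T x\<^sub>0) = 1 \<and> norm (x\<^sub>0 - x) < \<epsilon>"
      if x: "norm x = 1" "1 - \<delta> < norm (blinfun_apply T x)" for x
    proof -
      obtain c where c: "norm c = 1"
        "blinfun_apply T (scale c x) = of_real (norm (blinfun_apply T x))"
        using ex_rotation[OF T(1)] by blast
      then have "c \<noteq> 0" by auto
      \<comment> \<open>Closeness applies to \<open>z\<close>, with value 1, and to the rotated
        \<open>x\<close>.\<close>
      have "norm (z - scale c x) < \<epsilon>"
        using \<delta>(1) x z c by (intro \<delta>(2)[where a = 1]) (auto simp: norm_scale)
      \<comment> \<open>Multiplication by \<open>inverse c\<close> is an isometry, so rotating back
        moves \<open>z\<close> next to \<open>x\<close> and keeps the modulus of its value at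
        1.\<close>
      moreover have "scale (inverse c) z - x = scale (inverse c) (z - scale c x)"
        using \<open>c \<noteq> 0\<close> by (simp add: scale_right_diff_distrib)
      ultimately have "norm (scale (inverse c) z - x) < \<epsilon>"
        using c(1) by (simp add: norm_scale norm_inverse)
      moreover have "norm (blinfun_apply T (scale (inverse c) z)) = 1"
        using T(1) z(2) c(1) by (simp add: bounded_ops_def norm_inverse)
      ultimately show ?thesis
        using z(1) c(1) by (intro bexI[of _ "scale (inverse c) z"]) (auto simp: norm_scale norm_inverse)
    qed
    with \<delta>(1) show ?thesis by auto
  qed
  moreover have "T \<in> NA scale (*)"
    using T z by (auto simp: NA_def intro!: bexI[of _ z])
  ultimately show "T \<in> A_norm scale (*)"
    using T by (simp add: A_norm_def)
qed (auto simp: A_norm_def NA_def)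

end

section \<open>The pairing of bounded and summable sequences\<close>

lemma norm_l1_functional_apply_le:
  "norm (blinfun_apply (l1_functional y) x) \<le> norm y * norm x"
  using norm_blinfun[of "l1_functional y" x] by (simp add: norm_l1_functional)

text \<open>The termwise defects \<open>d n\<close> in the estimate are nonnegative, and equality
  forces their sum to be 0, so each vanishes; then cancel \<open>seq_l1 x n\<close>.\<close>

lemma norming_pair_imp_norm_eq:
  fixes y :: "'k::{real_normed_field,banach} linf" and x :: "'k l1"
  assumes eq: "norm (blinfun_apply (l1_functional y) x) = norm y * norm x"
    and "seq_l1 x n \<noteq> 0"
  shows "norm (apply_bcontfun y n) = norm y"
proof -
  define d where "d n = norm y * norm (seq_l1 x n) - norm (apply_bcontfun y n * seq_l1 x n)" for n
  have d0: "d n \<ge> 0" for n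
    by (simp add: d_def norm_mult mult_right_mono norm_bounded)
  note sm = summable_mult[OF summable_norm_seq_l1[of x], of "norm y"]
  have sd: "summable d"
    unfolding d_def by (rule summable_diff[OF sm summable_l1_linf])
  have "norm y * norm x \<le> (\<Sum>n. norm (apply_bcontfun y n * seq_l1 x n))"
    using summable_norm[OF summable_l1_linf, of y x] by (simp add: eq[symmetric] l1_functional.rep_eq)
  moreover have "suminf d = norm y * norm x - (\<Sum>n. norm (apply_bcontfun y n * seq_l1 x n))"
    unfolding d_def suminf_diff[OF sm summable_l1_linf, symmetric]
    by (simp add: norm_l1.rep_eq suminf_mult[OF summable_norm_seq_l1])
  ultimately have "suminf d = 0"
    using suminf_nonneg[OF sd d0] by linarith
  then have "d n = 0"
    using suminf_eq_zero_iff[OF sd d0] by simp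
  with assms(2) show ?thesis by (simp add: d_def norm_mult)
qed

lemma A_normE:
  assumes "T \<in> A_norm sX sY" "\<epsilon> > 0"
  obtains \<eta> where "\<eta> > 0"
    "\<And>x. norm x = 1 \<Longrightarrow> 1 - \<eta> < norm (blinfun_apply T x) \<Longrightarrow>
       \<exists>x\<^sub>0. norm x\<^sub>0 = 1 \<and> norm (blinfun_apply T x\<^sub>0) = 1 \<and> norm (x\<^sub>0 - x) < \<epsilon>"
proof -
  from assms obtain \<eta> where "\<eta> > 0" "\<forall>x\<in>sphere 0 1. 1 - \<eta> < norm (blinfun_apply T x) \<longrightarrow>
      (\<exists>x\<^sub>0\<in>sphere 0 1. norm (blinfun_apply T x\<^sub>0) = 1 \<and> norm (x\<^sub>0 - x) < \<epsilon>)"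
    unfolding A_norm_def by blast
  with that show thesis by (metis mem_sphere_0)
qed

section \<open>A functional on \<open>l1\<close> outside the class\<close>

lemma ex_l1_functional_not_A_norm:
  "\<exists>y\<in>sphere (0 :: 'k::{real_normed_field,banach} linf) 1.
     l1_functional y \<in> NA l1_scale (*) \<and> l1_functional y \<notin> A_norm l1_scale (*)"
proof -
  \<comment> \<open>The general formula would give 0 at index 0; the value 1 there makes
    \<open>unit_l1 0\<close> norming.\<close>
  define t :: "nat \<Rightarrow> real" where "t n = (if n = 0 then 1 else 1 - 1 / real (Suc n))" for n
  have t: "\<bar>t n\<bar> \<le> 1" "n \<noteq> 0 \<Longrightarrow> \<bar>t n\<bar> \<noteq> 1" for n
    by (auto simp: t_def field_simps)
  define y :: "'k linf" where "y = Bcontfun (\<lambda>n. of_real (t n))"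
  have "(\<lambda>n. of_real (t n) :: 'k) \<in> bcontfun"
    unfolding bcontfun_nat_iff bounded_iff using t(1) by auto
  then have y: "apply_bcontfun y n = of_real (t n)" for n
    by (simp add: y_def Bcontfun_inverse)
  have ny: "norm y = 1"
  proof (rule antisym)
    show "norm y \<le> 1" by (rule norm_linf_le) (simp add: y t(1))
    show "1 \<le> norm y" using norm_bounded[of y 0] by (simp add: y t_def)
  qed
  have ops: "l1_functional y \<in> bounded_ops l1_scale (*)"
    using bij_betw_imp_surj_on[OF bij_betw_l1_functional] by blast
  have NA: "l1_functional y \<in> NA l1_scale (*)"
    unfolding NA_def using ops
    by (auto simp: norm_l1_functional ny y t_def intro!: bexI[of _ "unit_l1 0"])
  have "l1_functional y \<notin> A_norm l1_scale (*)"
  proof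
    assume "l1_functional y \<in> A_norm l1_scale (*)"
    \<comment> \<open>The single choice \<open>\<epsilon> = 1\<close> already leads to a
      contradiction.\<close>
    then obtain \<eta> where \<eta>: "\<eta> > 0" and A: "\<And>x. norm x = 1 \<Longrightarrow>
        1 - \<eta> < norm (blinfun_apply (l1_functional y) x) \<Longrightarrow>
        \<exists>x\<^sub>0. norm x\<^sub>0 = 1 \<and> norm (blinfun_apply (l1_functional y) x\<^sub>0) = 1 \<and> norm (x\<^sub>0 - x) < 1"
      by (rule A_normE[OF _ zero_less_one]) blast
    \<comment> \<open>Index 0 must be avoided because \<open>t 0 = 1\<close>; hence the shift from
      \<open>k\<close> to \<open>Suc k\<close>.\<close>
    obtain m where m: "inverse (real (Suc m)) < \<eta>" "m > 0"
    proof -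
      obtain k where "inverse (real (Suc k)) < \<eta>" using reals_Archimedean \<eta> by blast
      moreover have "inverse (real (Suc (Suc k))) \<le> inverse (real (Suc k))"
        by (intro le_imp_inverse_le) auto
      ultimately show thesis using that[of "Suc k"] by linarith
    qed
    then have "1 - \<eta> < norm (blinfun_apply (l1_functional y) (unit_l1 m))"
      unfolding l1_functional_unit y norm_of_real by (auto simp: t_def inverse_eq_divide)
    then obtain x where x: "norm x = 1" "norm (blinfun_apply (l1_functional y) x) = 1"
      "norm (x - unit_l1 m) < 1"
      using A[of "unit_l1 m"] by auto
    \<comment> \<open>Since \<open>t m\<close> has modulus other than 1, a norming \<open>x\<close>
      vanishes at \<open>m\<close>, where \<open>unit_l1 m\<close> is 1: their distance is at least
      1.\<close>
    have "seq_l1 x m = 0"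
      using norming_pair_imp_norm_eq[of y x m] x ny m t(2)[of m] by (auto simp: y)
    then have "norm (seq_l1 (x - unit_l1 m) m) = 1"
      by (simp add: minus_l1.rep_eq unit_l1.rep_eq)
    with x(3) norm_seq_l1_le[of "x - unit_l1 m" m] show False by simp
  qed
  with ny NA show ?thesis by auto
qed

section \<open>Functionals on \<open>linf\<close> from the canonical embedding of \<open>l1\<close>
  into its bidual\<close>

lift_definition linf_functional ::
  "'k::{real_normed_field,banach} l1 \<Rightarrow> ('k linf \<Rightarrow>\<^sub>L 'k)"
  is "\<lambda>x y. blinfun_apply (l1_functional y) x"
proof (rule bounded_linear_intro)
  fix x :: "'k l1" and y z :: "'k linf" and r :: real
  note s = summable_norm_cancel[OF summable_l1_linf]
  show "blinfun_apply (l1_functional (y + z)) x =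
        blinfun_apply (l1_functional y) x + blinfun_apply (l1_functional z) x"
    by (simp add: l1_functional.rep_eq distrib_right suminf_add[OF s s])
  show "blinfun_apply (l1_functional (r *\<^sub>R y)) x = r *\<^sub>R blinfun_apply (l1_functional y) x"
    by (simp add: l1_functional.rep_eq suminf_scaleR_right[OF s])
  show "norm (blinfun_apply (l1_functional y) x) \<le> norm y * norm x"
    by (rule norm_l1_functional_apply_le)
qed

lemma linf_functional_in_bounded_ops: "linf_functional x \<in> bounded_ops linf_scale (*)"
  unfolding bounded_ops_def
  by (simp add: linf_functional.rep_eq l1_functional.rep_eq mult.assoc
        suminf_mult[OF summable_norm_cancel[OF summable_l1_linf]])

lemma ex_linf_functional_not_A_norm:
  "\<exists>f\<in>NA (linf_scale :: 'k::{real_normed_field,banach} \<Rightarrow> _) (*) \<inter> dual_sphere linf_scale.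
     f \<notin> A_norm linf_scale (*)"
proof -
  \<comment> \<open>All weights are nonzero, so a norming sequence is unimodular at every
    index.\<close>
  define x :: "'k l1" where "x = Abs_l1 (\<lambda>n. of_real ((1/2) ^ Suc n))"
  have half: "(\<lambda>n. (1/2 :: real) ^ Suc n) sums 1" by (rule power_half_series)
  then have x: "seq_l1 x n = of_real ((1/2) ^ Suc n)" for n
    by (simp add: x_def Abs_l1_inverse norm_power norm_divide norm_mult sums_iff)
  have nx: "norm x = 1"
    using half by (simp add: norm_l1.rep_eq x norm_power norm_divide norm_mult sums_iff)
  have fin: "(\<lambda>n. if n \<in> A then 0 else 1 :: 'k) \<in> bcontfun" for A :: "nat set"
    unfolding bcontfun_nat_iff bounded_iff by (auto intro!: exI[of _ 1])
  \<comment> \<open>One minus the indicator of \<open>A\<close>: \<open>z {}\<close> norms the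
    functional, and \<open>z {m}\<close> almost norms it for large \<open>m\<close>.\<close>
  define z :: "nat set \<Rightarrow> 'k linf" where "z A = Bcontfun (\<lambda>n. if n \<in> A then 0 else 1)" for A
  have z: "apply_bcontfun (z A) n = (if n \<in> A then 0 else 1)" for A n
    by (simp add: z_def Bcontfun_inverse[OF fin])
  have nz: "norm (z A) = 1" if "k \<notin> A" for A k
  proof (rule antisym)
    show "norm (z A) \<le> 1" by (rule norm_linf_le) (simp add: z)
    show "1 \<le> norm (z A)" using norm_bounded[of "z A" k] that by (simp add: z)
  qed
  have sx: "seq_l1 x sums 1"
    using sums_of_real[OF half, where 'a='k] by (simp add: x[abs_def] o_def)
  have fz0: "blinfun_apply (linf_functional x) (z {}) = 1"
    using sx by (simp add: linf_functional.rep_eq l1_functional.rep_eq z sums_iff)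
  have fz: "blinfun_apply (linf_functional x) (z {m}) = of_real (1 - (1/2) ^ Suc m)" for m
  proof -
    \<comment> \<open>Zeroing coordinate \<open>m\<close> costs exactly the weight at
      \<open>m\<close>.\<close>
    have "(\<lambda>n. seq_l1 x n - (if n = m then seq_l1 x n else 0)) sums (1 - seq_l1 x m)"
      by (intro sums_diff sx sums_single)
    also have "(\<lambda>n. seq_l1 x n - (if n = m then seq_l1 x n else 0)) =
        (\<lambda>n. apply_bcontfun (z {m}) n * seq_l1 x n)"
      by (auto simp: z)
    finally have "blinfun_apply (linf_functional x) (z {m}) = 1 - seq_l1 x m"
      by (simp only: linf_functional.rep_eq l1_functional.rep_eq sums_iff)
    then show ?thesis by (simp add: x)
  qed
  have nf: "norm (linf_functional x) = 1"
  proof (rule antisym)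
    show "norm (linf_functional x) \<le> 1"
      using norm_l1_functional_apply_le[of _ x] nx
      by (intro norm_blinfun_bound) (auto simp: linf_functional.rep_eq)
    show "1 \<le> norm (linf_functional x)"
      using norm_blinfun[of "linf_functional x" "z {}"] by (simp add: fz0 nz)
  qed
  have NA: "linf_functional x \<in> NA linf_scale (*)"
    unfolding NA_def using linf_functional_in_bounded_ops
    by (auto simp: nf fz0 nz intro!: bexI[of _ "z {}"])
  have "linf_functional x \<notin> A_norm linf_scale (*)"
  proof
    assume "linf_functional x \<in> A_norm linf_scale (*)"
    then obtain \<eta> where \<eta>: "\<eta> > 0" and A: "\<And>u. norm u = 1 \<Longrightarrow>
        1 - \<eta> < norm (blinfun_apply (linf_functional x) u) \<Longrightarrow>
        \<exists>v. norm v = 1 \<and> norm (blinfun_apply (linf_functional x) v) = 1 \<and> norm (v - u) < 1"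
      by (rule A_normE[OF _ zero_less_one]) blast
    obtain m where m: "(1/2 :: real) ^ m < \<eta>"
      using real_arch_pow_inv[OF \<eta>, of "1/2"] by auto
    have "(1/2 :: real) ^ Suc m \<le> (1/2) ^ m" "(1/2 :: real) ^ Suc m \<le> 1"
      by (rule power_decreasing power_le_one; simp)+
    then have "1 - \<eta> < norm (blinfun_apply (linf_functional x) (z {m}))"
      using m unfolding fz norm_of_real by linarith
    then obtain v where v: "norm v = 1" "norm (blinfun_apply (linf_functional x) v) = 1"
      "norm (v - z {m}) < 1"
      using A[of "z {m}"] nz[of "Suc m" "{m}"] by auto
    \<comment> \<open>\<open>v\<close> is unimodular at \<open>m\<close> while \<open>z {m}\<close>
      is 0 there, so they are at distance at least 1.\<close>
    have "norm (apply_bcontfun v m) = 1"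
      using norming_pair_imp_norm_eq[of v x m] v nx by (simp add: x linf_functional.rep_eq)
    then have "norm (apply_bcontfun (v - z {m}) m) = 1" by (simp add: z)
    with v(3) norm_bounded[of "v - z {m}" m] show False by simp
  qed
  with nf NA linf_functional_in_bounded_ops[of x] show ?thesis by auto
qed

theorem proposition2p2:
  fixes scaleC :: "complex \<Rightarrow> 'b::banach \<Rightarrow> 'b"
  shows
    "((uniformly_convex TYPE('a::banach) \<longrightarrow>
         dual_sphere (scaleR :: real \<Rightarrow> 'a \<Rightarrow> 'a) = A_norm scaleR (*))
      \<and> (\<exists>y\<in>sphere (0 :: real linf) 1.
           l1_functional y \<in> NA l1_scale (*) \<and> l1_functional y \<notin> A_norm l1_scale (*))
      \<and> (\<exists>f\<in>NA (linf_scale :: real \<Rightarrow> _) (*) \<inter> dual_sphere linf_scale.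
           f \<notin> A_norm linf_scale (*)))
     \<and>
     ((banach_over scaleC \<and> uniformly_convex TYPE('b) \<longrightarrow>
         dual_sphere scaleC = A_norm scaleC (*))
      \<and> (\<exists>y\<in>sphere (0 :: complex linf) 1.
           l1_functional y \<in> NA l1_scale (*) \<and> l1_functional y \<notin> A_norm l1_scale (*))
      \<and> (\<exists>f\<in>NA (linf_scale :: complex \<Rightarrow> _) (*) \<inter> dual_sphere linf_scale.
           f \<notin> A_norm linf_scale (*)))"
  \<comment> \<open>Over the reals, \<open>scaleR\<close> is the only multiplication satisfying
    \<open>banach_over\<close>; over the complex numbers it is the given
    \<open>scaleC\<close>.\<close>
  using banach_over.uniformly_convex_dual_sphere_eq[OF banach_over_scaleR]
    banach_over.uniformly_convex_dual_sphere_eq[of scaleC]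
  by (intro conjI impI ex_l1_functional_not_A_norm ex_linf_functional_not_A_norm) auto

end
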